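(* Any search algorithm that accesses the labels only through a $\lambda$-oracle with any number of linear constraints cannot find $y^*$ using fewer than $M$ iterations in the worst case, where $M$ is the number of labels. That is, for every integer $M\ge1$ and every deterministic adaptive search algorithm of this kind, there exists a problem $(\mathcal{Y},h,g)$ with $M$ labels such that $y^*=\arg\max_{y\in\mathcal{Y}}\Phi(y)$ is not among the labels returned by the oracle to the algorithm in its first $M-1$ queries.
   Context: A problem $(\mathcal{Y},h,g)$ with $M$ labels consists of a set $\mathcal{Y}$ of $M$ labels and functions $h:\mathcal{Y}\to\mathbb{R}$, $g:\mathcal{Y}\to[0,\infty)$; each label $y$ is identified with the point $(h(y),g(y))\in\mathbb{R}^2$. The objective is $\Phi(y)=h(y)g(y)$. In iteration $t$ the algorithm issues a query $(\lambda_t,\mathcal{A}_t)$, where $\lambda_t>0$ and $\mathcal{A}_t\subseteq\mathbb{R}^2$ is a closed convex region given by any number of linear constraints on $(h(y),g(y))$; the query may depend on all earlier answers. The oracle answers with a label maximizing $h(y)+\lambda_t g(y)$ among the labels $y\in\mathcal{Y}$ with $(h(y),g(y))\in\mathcal{A}_t$ (together with its values $h(y),g(y)$), or reports that no such label exists. The algorithm has no other access to $\mathcal{Y}$, $h$, $g$. *)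

theory Defs
  imports Complex_Main
begin

text \<open>
  A problem is given by a label set \<open>Y\<close> and functions \<open>h\<close>, \<open>g\<close>, of which only the values on
  \<open>Y\<close> matter. The type of labels is left arbitrary.
\<close>

definition is_problem :: "nat \<Rightarrow> 'l set \<Rightarrow> ('l \<Rightarrow> real) \<Rightarrow> ('l \<Rightarrow> real) \<Rightarrow> bool" where
  "is_problem M Y h g \<longleftrightarrow> finite Y \<and> card Y = M \<and> (\<forall>y\<in>Y. 0 \<le> g y)"

definition objective :: "('l \<Rightarrow> real) \<Rightarrow> ('l \<Rightarrow> real) \<Rightarrow> 'l \<Rightarrow> real" where
  "objective h g y = h y * g y"

text \<open>
  A triple \<open>(a, b, c)\<close> stands for the linear constraint \<open>a * h y + b * g y \<le> c\<close>. The set of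
  constraints may be empty, finite or infinite, so that the regions are exactly the closed convex
  subsets of the plane.
\<close>

datatype query = Query (weight: real) (constraints: "(real \<times> real \<times> real) set")

definition region :: "query \<Rightarrow> (real \<times> real) set" where
  "region q = {(u, v). \<forall>(a, b, c) \<in> constraints q. a * u + b * v \<le> c}"

definition feasible :: "'l set \<Rightarrow> ('l \<Rightarrow> real) \<Rightarrow> ('l \<Rightarrow> real) \<Rightarrow> query \<Rightarrow> 'l \<Rightarrow> bool" where
  "feasible Y h g q y \<longleftrightarrow> y \<in> Y \<and> (h y, g y) \<in> region q"

type_synonym 'l answer = "('l \<times> real \<times> real) option"

text \<open>
  This is a relation rather than a function: if several feasible labels are maximal, each of them
  is an admissible answer.
\<close>

definition oracle_answer ::
    "'l set \<Rightarrow> ('l \<Rightarrow> real) \<Rightarrow> ('l \<Rightarrow> real) \<Rightarrow> query \<Rightarrow> 'l answer \<Rightarrow> bool" where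
  "oracle_answer Y h g q r \<longleftrightarrow>
     (case r of
        None \<Rightarrow> \<not> (\<exists>y. feasible Y h g q y)
      | Some (y, u, v) \<Rightarrow>
          is_arg_max (\<lambda>y. h y + weight q * g y) (feasible Y h g q) y \<and> u = h y \<and> v = g y)"

text \<open>
  A deterministic adaptive algorithm maps the list of answers received so far (oldest first) to its
  next query. An algorithm that stops early is covered by letting it go on with arbitrary queries.
\<close>

type_synonym 'l algorithm = "'l answer list \<Rightarrow> query"

definition search_algorithm :: "'l algorithm \<Rightarrow> bool" where
  "search_algorithm alg \<longleftrightarrow> (\<forall>rs. 0 < weight (alg rs))"

definition transcript ::
    "'l algorithm \<Rightarrow> 'l set \<Rightarrow> ('l \<Rightarrow> real) \<Rightarrow> ('l \<Rightarrow> real) \<Rightarrow> 'l answer list \<Rightarrow> bool" where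
  "transcript alg Y h g rs \<longleftrightarrow>
     (\<forall>t<length rs. oracle_answer Y h g (alg (take t rs)) (rs ! t))"

definition returned_labels :: "'l answer list \<Rightarrow> 'l set" where
  "returned_labels rs = {y. \<exists>u v. Some (y, u, v) \<in> set rs}"

text \<open>Quantifying over all transcripts of a given length is never vacuous:\<close>

lemma oracle_answer_exists:
  assumes "finite Y"
  shows "\<exists>r. oracle_answer Y h g q r"
proof (cases "\<exists>y. feasible Y h g q y")
  case False
  then have "oracle_answer Y h g q None"
    by (simp add: oracle_answer_def)
  then show ?thesis ..
next
  case True
  let ?f = "\<lambda>y. h y + weight q * g y"
  let ?F = "{y. feasible Y h g q y}"
  have "finite ?F"
    using assms by (rule rev_finite_subset) (auto simp: feasible_def)
  with True obtain y where y: "y \<in> ?F" "?f y = Max (?f ` ?F)"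
    using Max_in[of "?f ` ?F"] by (metis (no_types, lifting) empty_iff finite_imageI image_iff
        image_is_empty mem_Collect_eq)
  have "?f z \<le> ?f y" if "feasible Y h g q z" for z
    using \<open>finite ?F\<close> that y(2) by simp
  with y(1) have "oracle_answer Y h g q (Some (y, h y, g y))"
    by (auto simp: oracle_answer_def is_arg_max_linorder)
  then show ?thesis ..
qed

lemma transcript_exists:
  assumes "finite Y"
  shows "\<exists>rs. length rs = n \<and> transcript alg Y h g rs"
proof (induction n)
  case 0
  show ?case by (simp add: transcript_def)
next
  case (Suc n)
  then obtain rs where rs: "length rs = n" "transcript alg Y h g rs" by blast
  obtain r where "oracle_answer Y h g (alg rs) r"
    using oracle_answer_exists[OF assms] by blast
  with rs have "transcript alg Y h g (rs @ [r])"
    by (auto simp: transcript_def nth_append less_Suc_eq)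
  with rs(1) show ?case by (intro exI[of _ "rs @ [r]"]) simp
qed

end

theory Submission imports Defs begin

text \<open>
  Put all labels on the half line \<open>h = -1\<close>, \<open>g > 0\<close>. There the objective is \<open>-g\<close>, while for every
  \<open>\<lambda> > 0\<close> the oracle prefers large \<open>g\<close>: it returns the feasible label with the largest \<open>g\<close>, but the
  one with the smallest \<open>g\<close> is wanted. The adversary fixes the values \<open>g\<^sub>0 > g\<^sub>1 > \<dots>\<close> one per
  query: if the region of query \<open>n\<close> contains a point with \<open>g\<close> positive and below all earlier values,
  \<open>g\<^sub>n\<close> is chosen to be such a point; otherwise no later label is feasible. In both cases query \<open>n\<close>
  reveals only labels with index at most \<open>n\<close>, so \<open>M - 1\<close> queries do not reveal the last label. The
  values of \<open>g\<close> are distinct, so there are no ties and the answers do not depend on later choices.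
\<close>

definition pos_decreasing :: "(nat \<Rightarrow> real) \<Rightarrow> bool" where
  "pos_decreasing \<gamma> \<longleftrightarrow> (\<forall>n. 0 < \<gamma> n) \<and> (\<forall>i j. i < j \<longrightarrow> \<gamma> j < \<gamma> i)"

text \<open>The numbering \<open>d\<close> separates labels from values: the adversary revises
  \<open>\<gamma>\<close> while the labels stay fixed.\<close>

abbreviation line_answer ::
    "'l set \<Rightarrow> ('l \<Rightarrow> nat) \<Rightarrow> (nat \<Rightarrow> real) \<Rightarrow> query \<Rightarrow> 'l answer \<Rightarrow> bool" where
  "line_answer Y d \<gamma> \<equiv> oracle_answer Y (\<lambda>_. -1) (\<lambda>y. \<gamma> (d y))"

abbreviation line_transcript ::
    "'l algorithm \<Rightarrow> 'l set \<Rightarrow> ('l \<Rightarrow> nat) \<Rightarrow> (nat \<Rightarrow> real) \<Rightarrow> 'l answer list \<Rightarrow> bool" where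
  "line_transcript alg Y d \<gamma> \<equiv> transcript alg Y (\<lambda>_. -1) (\<lambda>y. \<gamma> (d y))"

lemma pos_decreasing_inverse: "pos_decreasing (\<lambda>n. 1 / real (Suc n))"
  by (auto simp: pos_decreasing_def divide_strict_left_mono)

lemma pos_decreasing_less_iff: "pos_decreasing \<gamma> \<Longrightarrow> \<gamma> i < \<gamma> j \<longleftrightarrow> j < i"
  unfolding pos_decreasing_def by (metis less_asym linorder_neqE_nat)

text \<open>Dropping the values at positions \<open>n\<close> to \<open>j - 1\<close> keeps the
  sequence decreasing. Thus any value occurring later could have been chosen at position
  \<open>n\<close>.\<close>

lemma pos_decreasing_replace_tail:
  assumes "pos_decreasing \<gamma>" "n \<le> j"
  obtains \<gamma>' where "pos_decreasing \<gamma>'" "\<forall>i<n. \<gamma>' i = \<gamma> i" "\<gamma>' n = \<gamma> j"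
proof
  let ?\<gamma>' = "\<lambda>i. if i < n then \<gamma> i else \<gamma> (i + (j - n))"
  show "pos_decreasing ?\<gamma>'" "\<forall>i<n. ?\<gamma>' i = \<gamma> i" "?\<gamma>' n = \<gamma> j"
    using assms by (auto simp: pos_decreasing_def)
qed

lemma line_answer_None:
  "line_answer Y d \<gamma> q None \<longleftrightarrow> (\<forall>y\<in>Y. (-1, \<gamma> (d y)) \<notin> region q)"
  by (auto simp: oracle_answer_def feasible_def)

text \<open>As \<open>h\<close> is constant and the weight positive, the larger \<open>g\<close>
  wins, which means the smaller index.\<close>

lemma line_answer_Some:
  assumes "pos_decreasing \<gamma>" "0 < weight q"
  shows "line_answer Y d \<gamma> q (Some (y, u, v)) \<longleftrightarrow>
    u = -1 \<and> v = \<gamma> (d y) \<and> y \<in> Y \<and> (-1, v) \<in> region q \<and>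
    (\<forall>z\<in>Y. (-1, \<gamma> (d z)) \<in> region q \<longrightarrow> d y \<le> d z)"
  using assms pos_decreasing_less_iff[OF assms(1)]
  by (auto simp: oracle_answer_def feasible_def is_arg_max_def not_less[symmetric])

text \<open>On indices below \<open>n\<close> the two sequences agree, so a label returned in one
  problem is feasible in the other. Two returned labels thus have index at most that of each other,
  and injectivity of \<open>d\<close> identifies them.\<close>

lemma line_answer_eq:
  assumes "inj_on d Y" "pos_decreasing \<gamma>" "pos_decreasing \<gamma>'" "0 < weight q"
    and agree: "\<forall>i<n. \<gamma> i = \<gamma>' i"
    and "line_answer Y d \<gamma> q r" "\<forall>y u v. r = Some (y, u, v) \<longrightarrow> d y < n"
    and "line_answer Y d \<gamma>' q r'" "\<forall>y u v. r' = Some (y, u, v) \<longrightarrow> d y < n"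
  shows "r = r'"
proof (cases r)
  case None
  then show ?thesis
    using assms by (cases r') (fastforce simp: line_answer_None line_answer_Some)+
next
  case (Some a)
  obtain y u v where r: "r = Some (y, u, v)" using Some by (cases a) auto
  show ?thesis
  proof (cases r')
    case None
    then show ?thesis using assms r by (auto simp: line_answer_None line_answer_Some)
  next
    case (Some b)
    obtain y' u' v' where r': "r' = Some (y', u', v')" using Some by (cases b) auto
    have *: "y \<in> Y" "y' \<in> Y" "u = -1" "u' = -1" "v = \<gamma> (d y)" "v' = \<gamma> (d y')"
      using assms r r' by (auto simp: line_answer_Some)
    have "d y \<le> d y'" "d y' \<le> d y"
      using assms r r' by (auto simp: line_answer_Some)
    then have "y = y'"
      using \<open>inj_on d Y\<close> * by (auto dest: inj_onD)
    then show ?thesis using r r' * by simp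
  qed
qed

lemma transcript_snoc:
  assumes "transcript alg Y h g rs" "length rs = Suc n"
  obtains rs' r where "rs = rs' @ [r]" "length rs' = n"
    "transcript alg Y h g rs'" "oracle_answer Y h g (alg rs') r"
proof -
  obtain rs' r where rs: "rs = rs' @ [r]" "length rs' = n"
    using assms(2) by (auto simp: length_Suc_conv_rev)
  moreover have "transcript alg Y h g rs'"
    unfolding transcript_def
  proof (intro allI impI)
    fix t assume "t < length rs'"
    then show "oracle_answer Y h g (alg (take t rs')) (rs' ! t)"
      using assms(1)[unfolded transcript_def, rule_format, of t] by (simp add: rs nth_append)
  qed
  moreover have "oracle_answer Y h g (alg rs') r"
    using assms(1)[unfolded transcript_def, rule_format, of n] rs by (simp add: nth_append)
  ultimately show thesis by (rule that)
qed

lemma choose_next_value: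
  assumes d: "d ` Y = {..<M}" and w: "0 < weight q" and \<gamma>: "pos_decreasing \<gamma>"
  obtains \<gamma>' where "pos_decreasing \<gamma>'" "\<forall>i<n. \<gamma>' i = \<gamma> i"
    "\<And>\<delta> y u v. \<lbrakk>pos_decreasing \<delta>; \<forall>i<Suc n. \<delta> i = \<gamma>' i; line_answer Y d \<delta> q (Some (y, u, v))\<rbrakk>
       \<Longrightarrow> d y < Suc n"
proof -
  define ok where
    "ok \<gamma>' \<longleftrightarrow> pos_decreasing \<gamma>' \<and> (\<forall>i<n. \<gamma>' i = \<gamma> i) \<and> (-1, \<gamma>' n) \<in> region q" for \<gamma>'
  \<comment> \<open>The default \<open>\<gamma>\<close> is for the case that no admissible
    continuation enters the region at position \<open>n\<close>.\<close>
  define \<gamma>' where "\<gamma>' = (if \<exists>\<delta>. ok \<delta> then SOME \<delta>. ok \<delta> else \<gamma>)"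
  have ok: "ok \<gamma>'" if "ok \<delta>" for \<delta>
    using that someI[of ok \<delta>] by (auto simp: \<gamma>'_def)
  have \<gamma>': "pos_decreasing \<gamma>'" "\<forall>i<n. \<gamma>' i = \<gamma> i"
    using ok \<gamma> by (cases "\<exists>\<delta>. ok \<delta>"; auto simp: \<gamma>'_def ok_def)+
  moreover have "d y < Suc n"
    if \<delta>: "pos_decreasing \<delta>" "\<forall>i<Suc n. \<delta> i = \<gamma>' i"
      and ans: "line_answer Y d \<delta> q (Some (y, u, v))" for \<delta> y u v
  proof (rule ccontr)
    assume far: "\<not> d y < Suc n"
    \<comment> \<open>Moving the far feasible value to position \<open>n\<close> gives a witness for
      \<open>ok\<close>, so the chosen \<open>\<gamma>'\<close> has its own value at
      \<open>n\<close> in the region. The label of index \<open>n\<close> is then feasible and beats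
      \<open>y\<close>.\<close>
    obtain \<eta> where \<eta>: "pos_decreasing \<eta>" "\<forall>i<n. \<eta> i = \<delta> i" "\<eta> n = \<delta> (d y)"
      using pos_decreasing_replace_tail[OF \<delta>(1), of n "d y"] far by auto
    have y: "y \<in> Y" "(-1, \<delta> (d y)) \<in> region q"
      and least: "\<And>z. z \<in> Y \<Longrightarrow> (-1, \<delta> (d z)) \<in> region q \<Longrightarrow> d y \<le> d z"
      using ans \<delta>(1) w by (auto simp: line_answer_Some)
    have "ok \<eta>" using \<eta> \<delta>(2) \<gamma>' y by (auto simp: ok_def)
    then have "(-1, \<delta> n) \<in> region q"
      using ok \<delta>(2) by (simp add: ok_def)
    moreover have "d y < M" using d y(1) by blast
    then have "n \<in> d ` Y" using d far by simp
    ultimately show False using least far by fastforce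
  qed
  ultimately show thesis by (rule that)
qed

text \<open>Ranging over all \<open>\<gamma>'\<close> that agree below \<open>n\<close> leaves the
  later values free for the induction. The answers \<open>rs\<close> must be common to all of them,
  so that the next query \<open>alg rs\<close> is known before the value at \<open>n\<close> is
  fixed.\<close>

lemma adversary:
  assumes "finite Y" "inj_on d Y" and d: "d ` Y = {..<M}" and alg: "search_algorithm alg"
  shows "\<exists>\<gamma> rs. pos_decreasing \<gamma> \<and>
    (\<forall>\<gamma>' rs'. pos_decreasing \<gamma>' \<and> (\<forall>i<n. \<gamma>' i = \<gamma> i) \<and> length rs' = n \<and>
       line_transcript alg Y d \<gamma>' rs' \<longrightarrow> rs' = rs \<and> (\<forall>y\<in>returned_labels rs'. d y < n))"
proof (induction n)
  case 0
  show ?case using pos_decreasing_inverse by (auto simp: returned_labels_def)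
next
  case (Suc n)
  then obtain \<gamma> rs where \<gamma>: "pos_decreasing \<gamma>"
    and IH: "\<And>\<gamma>' rs'. \<lbrakk>pos_decreasing \<gamma>'; \<forall>i<n. \<gamma>' i = \<gamma> i; length rs' = n;
       line_transcript alg Y d \<gamma>' rs'\<rbrakk> \<Longrightarrow> rs' = rs \<and> (\<forall>y\<in>returned_labels rs'. d y < n)"
    by blast
  have w: "0 < weight (alg rs)" using alg by (simp add: search_algorithm_def)
  obtain \<gamma>1 where \<gamma>1: "pos_decreasing \<gamma>1" "\<forall>i<n. \<gamma>1 i = \<gamma> i"
    and near: "\<And>\<delta> y u v. \<lbrakk>pos_decreasing \<delta>; \<forall>i<Suc n. \<delta> i = \<gamma>1 i;
       line_answer Y d \<delta> (alg rs) (Some (y, u, v))\<rbrakk> \<Longrightarrow> d y < Suc n"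
    using choose_next_value[OF d w \<gamma>, of n] by blast
  \<comment> \<open>The problem given by \<open>\<gamma>1\<close> itself serves as reference: every
    continuation that agrees with it up to \<open>n\<close> receives this same answer.\<close>
  obtain r where r: "line_answer Y d \<gamma>1 (alg rs) r"
    using oracle_answer_exists[OF assms(1)] by blast
  have "rs' = rs @ [r] \<and> (\<forall>y\<in>returned_labels rs'. d y < Suc n)"
    if \<delta>: "pos_decreasing \<delta>" "\<forall>i<Suc n. \<delta> i = \<gamma>1 i"
      and rs': "length rs' = Suc n" "line_transcript alg Y d \<delta> rs'" for \<delta> rs'
  proof -
    obtain rs1 r1 where rs1: "rs' = rs1 @ [r1]" "length rs1 = n"
      "line_transcript alg Y d \<delta> rs1" "line_answer Y d \<delta> (alg rs1) r1"
      using transcript_snoc[OF rs'(2,1)] by blast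
    have eq: "rs1 = rs" and old: "\<forall>y\<in>returned_labels rs1. d y < n"
      using IH[OF \<delta>(1) _ rs1(2,3)] \<delta>(2) \<gamma>1(2) by auto
    have new: "\<forall>y u v. r1 = Some (y, u, v) \<longrightarrow> d y < Suc n"
      using near \<delta> rs1(4) eq by blast
    moreover have "\<forall>y u v. r = Some (y, u, v) \<longrightarrow> d y < Suc n"
      using near[OF \<gamma>1(1)] r by blast
    ultimately have "r1 = r"
      using line_answer_eq[OF assms(2) \<delta>(1) \<gamma>1(1) w \<delta>(2)] rs1(4) r eq by blast
    with eq rs1(1) old new show ?thesis
      by (fastforce simp: returned_labels_def)
  qed
  with \<gamma>1(1) show ?case by blast
qed

theorem theorem3:
  fixes M :: nat and alg :: "'l algorithm"
  assumes "M \<ge> 1"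
    and "\<exists>L :: 'l set. finite L \<and> card L = M"
    and "search_algorithm alg"
  shows "\<exists>(Y :: 'l set) h g y_star.
           is_problem M Y h g \<and>
           {y. is_arg_max (objective h g) (\<lambda>y. y \<in> Y) y} = {y_star} \<and>
           (\<forall>rs. length rs = M - 1 \<and> transcript alg Y h g rs \<longrightarrow> y_star \<notin> returned_labels rs)"
proof -
  obtain Y :: "'l set" where Y: "finite Y" "card Y = M" using assms(2) by blast
  obtain d where "bij_betw d Y {..<M}"
    using ex_bij_betw_finite_nat[OF Y(1)] Y(2) by (auto simp: atLeast0LessThan)
  then have d: "inj_on d Y" "d ` Y = {..<M}" by (auto simp: bij_betw_def)
  obtain \<gamma> where \<gamma>: "pos_decreasing \<gamma>"
    and hidden: "\<And>rs. \<lbrakk>length rs = M - 1; line_transcript alg Y d \<gamma> rs\<rbrakk>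
      \<Longrightarrow> \<forall>y\<in>returned_labels rs. d y < M - 1"
    using adversary[OF Y(1) d assms(3), of "M - 1"] by blast
  let ?h = "\<lambda>_ :: 'l. -1 :: real" and ?g = "\<lambda>y. \<gamma> (d y)"
  \<comment> \<open>The largest index is just out of reach of \<open>M - 1\<close> queries;
    \<open>M \<ge> 1\<close> ensures that a label carries it.\<close>
  have "M - 1 \<in> d ` Y" using d(2) assms(1) by simp
  then obtain y_star where ys: "y_star \<in> Y" "d y_star = M - 1" by auto
  have "is_problem M Y ?h ?g"
    using Y \<gamma> by (auto simp: is_problem_def pos_decreasing_def less_imp_le)
  moreover have "is_arg_max (objective ?h ?g) (\<lambda>y. y \<in> Y) y \<longleftrightarrow> y = y_star" for y
  proof -
    have "is_arg_max (objective ?h ?g) (\<lambda>y. y \<in> Y) y \<longleftrightarrow> y \<in> Y \<and> (\<forall>z\<in>Y. d z \<le> d y)"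
      using pos_decreasing_less_iff[OF \<gamma>] by (auto simp: is_arg_max_def objective_def not_less)
    also have "\<dots> \<longleftrightarrow> y \<in> Y \<and> d y = M - 1"
    proof -
      have "d z < M" if "z \<in> Y" for z using that d(2) by blast
      then have "d z \<le> M - 1" if "z \<in> Y" for z using that by fastforce
      with ys show ?thesis by (metis le_antisym)
    qed
    also have "\<dots> \<longleftrightarrow> y = y_star" using ys inj_onD[OF d(1)] by metis
    finally show ?thesis .
  qed
  moreover have "y_star \<notin> returned_labels rs"
    if "length rs = M - 1" "line_transcript alg Y d \<gamma> rs" for rs
    using hidden[OF that] ys(2) by auto
  ultimately show ?thesis
    by (intro exI[of _ Y] exI[of _ ?h] exI[of _ ?g] exI[of _ y_star]) auto
qed

end
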